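(* Suppose that $\mathcal{L}$ is a non-empty Cameron-Liebler $k$-set in $\mathrm{PG}(n,q)$ of parameter $x$. Then we have that for every $t$, such that $(k+1)\mid (t+1)$ and $2k+1 \leq t\leq n-1$, that $$x=1+\frac{C}{\begin{bmatrix} n-k-1 \\ t-k-1\end{bmatrix}_q},$$ for some $C \in \mathbb{N}$.
   Context: A Cameron-Liebler $k$-set in $\mathrm{PG}(n,q)$ is a set $\mathcal{L}$ of $k$-spaces whose characteristic vector lies in the row space of the point-($k$-space) incidence matrix of $\mathrm{PG}(n,q)$; it has parameter $x$ if $|\mathcal{L}|=x\begin{bmatrix} n \\ k\end{bmatrix}_q$, where $\begin{bmatrix} b \\ a\end{bmatrix}_q=\frac{(q^b-1)\cdots(q^{b-a+1}-1)}{(q^a-1)\cdots(q-1)}$ is the Gaussian binomial coefficient. *)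

theory Defs
  imports "HOL-Analysis.Analysis"
begin

(* PG(n,q) is the geometry of subspaces of the column space 'a^'n over the finite field 'a, where
   q = CARD('a) and CARD('n) = n + 1.  Dimensions are projective: a k-space is a subspace of
   vector space dimension k + 1, and the points are the 0-spaces. *)
definition pg_spaces :: "nat \<Rightarrow> ('a::{field,finite}^'n) set set" where
  "pg_spaces k = {U. vec.subspace U \<and> vec.dim U = k + 1}"

(* Matrices of the library are indexed by types, so rows and columns run over all sets of vectors;
   rows that are not points and columns that are not k-spaces are padded with zeros.  This leaves
   the row space unchanged up to zero coordinates outside the k-spaces. *)
definition pg_incidence_matrix ::
  "nat \<Rightarrow> real ^ (('a::{field,finite}^'n) set) ^ (('a^'n) set)" where
  "pg_incidence_matrix k =
     (\<chi> P K. if P \<in> pg_spaces 0 \<and> K \<in> pg_spaces k \<and> P \<subseteq> K then 1 else 0)"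

definition char_vector :: "'b::finite set \<Rightarrow> real ^ 'b" where
  "char_vector S = (\<chi> s. if s \<in> S then 1 else 0)"

definition cameron_liebler :: "nat \<Rightarrow> ('a::{field,finite}^'n) set set \<Rightarrow> bool" where
  "cameron_liebler k L \<longleftrightarrow>
     L \<subseteq> pg_spaces k \<and> char_vector L \<in> span (rows (pg_incidence_matrix k))"

(* For a \<le> b; the value is 0 if a > b (truncated subtraction makes a factor of the numerator 0). *)
definition gauss_binomial :: "nat \<Rightarrow> nat \<Rightarrow> nat \<Rightarrow> real" where
  "gauss_binomial q b a =
     (\<Prod>i<a. (real q ^ (b - i) - 1)) / (\<Prod>i<a. (real q ^ (a - i) - 1))"

(* n is the projective dimension CARD('n) - 1 *)
definition has_parameter :: "nat \<Rightarrow> ('a::{field,finite}^'n) set set \<Rightarrow> real \<Rightarrow> bool" where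
  "has_parameter k L x \<longleftrightarrow>
     real (card L) = x * gauss_binomial CARD('a) (CARD('n) - 1) k"

end

theory Submission
  imports Defs
begin

text \<open>A Cameron-Liebler set comes from a real weight on the points whose sum over a \<open>k\<close>-space is 1 or 0,
  according to membership; the parameter \<open>x\<close> is then the total weight. If \<open>(k+1) dvd (t+1)\<close>, a
  \<open>t\<close>-space \<open>T\<close> has integral weight: a power of \<open>q\<close> times the weight is an integer, and so is a
  Gaussian binomial times the weight (count the members inside \<open>T\<close>), and these two factors are
  coprime. If \<open>T\<close> contains a member \<open>K\<close>, the weight is positive, hence at least 1. Summing weight
  minus one over the \<open>t\<close>-spaces through \<open>K\<close> counts every point outside \<open>K\<close> equally often and gives
  \<open>x - 1\<close> times the Gaussian binomial of the theorem, which is therefore a natural number.\<close>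

section \<open>Counting subspaces over a finite field\<close>

lemma card_field_ge_2: "2 \<le> CARD('a::{field,finite})"
proof -
  have "card {0, 1::'a} \<le> CARD('a)"
    by (intro card_mono) auto
  then show ?thesis by simp
qed

lemma mem_span_of_scale:
  fixes v :: "'a::field^'n"
  assumes "c *s v \<in> vec.span S" "c \<noteq> 0"
  shows "v \<in> vec.span S"
  using vec.span_scale[OF assms(1), of "inverse c"] assms(2) by simp

text \<open>Each vector of the larger span is \<open>c *s v + y\<close> for exactly one scalar
  \<open>c\<close> and one \<open>y\<close> in the smaller span: two different scalars would put
  \<open>v\<close> into it.\<close>

lemma card_span_insert:
  fixes v :: "'a::{field,finite}^'n"
  assumes "v \<notin> vec.span S"
  shows "card (vec.span (insert v S)) = CARD('a) * card (vec.span S)"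
proof -
  let ?f = "\<lambda>(c, y). c *s v + y"
  have "inj_on ?f (UNIV \<times> vec.span S)"
  proof (rule inj_onI, clarify)
    fix c d y z
    assume y: "y \<in> vec.span S" and z: "z \<in> vec.span S" and eq: "c *s v + y = d *s v + z"
    have *: "(c - d) *s v = z - y"
      using eq by (simp add: vec.scale_left_diff_distrib algebra_simps)
    then have "(c - d) *s v \<in> vec.span S"
      using y z by (simp add: vec.span_diff)
    then have "c = d"
      using assms mem_span_of_scale[of "c - d" v S] by auto
    then show "c = d \<and> y = z" using * by simp
  qed
  moreover have "?f ` (UNIV \<times> vec.span S) = vec.span (insert v S)"
  proof (intro equalityI subsetI)
    fix x assume "x \<in> ?f ` (UNIV \<times> vec.span S)"
    then obtain c y where "x = c *s v + y" "y \<in> vec.span S" by auto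
    then show "x \<in> vec.span (insert v S)"
      by (auto simp: vec.span_breakdown_eq intro!: exI[of _ c])
  next
    fix x assume "x \<in> vec.span (insert v S)"
    then obtain c where "x - c *s v \<in> vec.span S"
      by (auto simp: vec.span_breakdown_eq)
    then show "x \<in> ?f ` (UNIV \<times> vec.span S)"
      by (intro image_eqI[of _ _ "(c, x - c *s v)"]) auto
  qed
  ultimately have "card (vec.span (insert v S)) = card (UNIV \<times> vec.span S :: ('a \<times> _) set)"
    by (metis card_image)
  then show ?thesis by (simp add: card_cartesian_product)
qed

lemma card_subspace:
  fixes U :: "('a::{field,finite}^'n) set"
  assumes "vec.subspace U"
  shows "card U = CARD('a) ^ vec.dim U"
proof -
  obtain B where B: "finite B" "vec.independent B" "vec.span B = U" "card B = vec.dim U"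
    using vec.basis_subspace_exists[OF assms] by metis
  have "card (vec.span B) = CARD('a) ^ card B"
    using B(1,2)
  proof (induction B rule: finite_induct)
    case (insert v B)
    then show ?case
      using vec.independent_insert[of v B] by (simp add: card_span_insert)
  qed simp
  then show ?thesis using B by simp
qed

section \<open>Counting the subspaces that contain one subspace and avoid another\<close>

lemma dim_span_Un_trivial_Int:
  fixes A W :: "('a::{field,finite}^'n) set"
  assumes "vec.subspace A" "vec.subspace W" "W \<inter> A = {0}"
  shows "vec.dim (vec.span (A \<union> W)) = vec.dim A + vec.dim W"
proof -
  have "vec.span (A \<union> W) = {x + y | x y. x \<in> A \<and> y \<in> W}"
    using assms by (simp add: vec.span_Un vec.span_eq_iff[THEN iffD2])
  moreover have "vec.dim (A \<inter> W) = 0"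
    using assms(3) by (simp add: Int_commute)
  ultimately show ?thesis
    using vec.dim_sums_Int[OF assms(1,2)] by (simp del: vec.dim_eq_0)
qed

text \<open>Covers two families at once: for \<open>A = {0}\<close> all \<open>m\<close>-dimensional
  subspaces between \<open>W\<close> and \<open>T\<close>, and for \<open>A\<close> of codimension
  \<open>m\<close> in \<open>T\<close> the complements of \<open>A\<close> in \<open>T\<close>
  through \<open>W\<close>. Here \<open>m\<close> is a vector space dimension, one more than the
  projective one.\<close>

definition transversals ::
  "('a::{field,finite}^'n) set \<Rightarrow> ('a^'n) set \<Rightarrow> nat \<Rightarrow> ('a^'n) set \<Rightarrow> ('a^'n) set set" where
  "transversals T A m W =
     {U. vec.subspace U \<and> vec.dim U = m \<and> W \<subseteq> U \<and> U \<subseteq> T \<and> U \<inter> A = {0}}"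

text \<open>A vector of \<open>A\<close> with a nonzero coefficient at \<open>v\<close> would put
  \<open>v\<close> into the span of \<open>A\<close> and \<open>W\<close>. This lets
  \<open>W\<close> grow by one vector in the induction below.\<close>

lemma span_insert_Int_trivial:
  fixes A W :: "('a::{field,finite}^'n) set"
  assumes A: "vec.subspace A" and W: "vec.subspace W" and "W \<inter> A = {0}"
    and v: "v \<notin> vec.span (A \<union> W)"
  shows "vec.span (insert v W) \<inter> A = {0}"
proof -
  have "x = 0" if x: "x \<in> vec.span (insert v W)" "x \<in> A" for x
  proof -
    obtain c where c: "x - c *s v \<in> W"
      using x(1) W by (auto simp: vec.span_breakdown_eq vec.span_eq_iff[THEN iffD2])
    have "c = 0"
    proof (rule ccontr)
      assume "c \<noteq> 0"
      have "x - (x - c *s v) \<in> vec.span (A \<union> W)"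
        using c x(2) by (intro vec.span_diff vec.span_base) auto
      then have "c *s v \<in> vec.span (A \<union> W)" by simp
      with \<open>c \<noteq> 0\<close> v show False
        using mem_span_of_scale by blast
    qed
    with c x(2) assms(3) show "x = 0" by auto
  qed
  then show ?thesis
    using A by (auto simp: vec.span_zero vec.subspace_0)
qed

text \<open>Double counting of the pairs of a transversal \<open>U\<close> and a vector
  \<open>v\<close> in \<open>U - W\<close>, by induction on the number of dimensions that
  \<open>W\<close> lacks. The product form avoids division.\<close>

lemma card_transversals_prod:
  fixes T A W :: "('a::{field,finite}^'n) set"
  assumes "vec.subspace T" "vec.subspace A" "vec.subspace W"
    and "A \<subseteq> T" "W \<subseteq> T" "W \<inter> A = {0}" "vec.dim W \<le> m"
  shows "real (card (transversals T A m W)) *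
           (\<Prod>i<m - vec.dim W. real CARD('a) ^ m - real CARD('a) ^ (vec.dim W + i)) =
         (\<Prod>i<m - vec.dim W.
           real CARD('a) ^ vec.dim T - real CARD('a) ^ (vec.dim A + vec.dim W + i))"
  using assms(3,5-7)
proof (induction "m - vec.dim W" arbitrary: W)
  case 0
  then have "vec.dim W = m" by simp
  moreover have "U = W" if "vec.subspace U" "vec.dim U = vec.dim W" "W \<subseteq> U" for U
    using that 0 vec.subspace_dim_equal[of W U] by simp
  ultimately have "U \<in> transversals T A m W \<longleftrightarrow> U = W" for U
    using 0 by (auto simp: transversals_def)
  then have "transversals T A m W = {W}" by (intro set_eqI) simp
  with \<open>vec.dim W = m\<close> show ?case by simp
next
  case (Suc r)
  let ?q = "real CARD('a)"
  let ?d = "vec.dim W"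
  let ?R = "T - vec.span (A \<union> W)"
  let ?P = "\<Prod>i<r. ?q ^ m - ?q ^ (Suc ?d + i)"
  let ?Q = "\<Prod>i<r. ?q ^ vec.dim T - ?q ^ (vec.dim A + Suc ?d + i)"
  have r: "m - ?d = Suc r" using Suc.hyps(2) by simp
  have spanW: "vec.span W = W" using Suc.prems by simp
  have AWT: "vec.span (A \<union> W) \<subseteq> T"
    using assms(1,4) Suc.prems by (intro vec.span_minimal) auto
  have cardR: "real (card ?R) = ?q ^ vec.dim T - ?q ^ (vec.dim A + ?d)"
  proof -
    have "card ?R = card T - card (vec.span (A \<union> W))"
      using AWT by (intro card_Diff_subset) auto
    moreover have "card (vec.span (A \<union> W)) \<le> card T"
      using AWT by (intro card_mono) auto
    moreover have "card (vec.span (A \<union> W)) = CARD('a) ^ (vec.dim A + ?d)"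
      using assms(2) Suc.prems by (simp only: card_subspace vec.subspace_span dim_span_Un_trivial_Int)
    ultimately show ?thesis
      using card_subspace[OF assms(1)] by (simp add: of_nat_diff)
  qed
  have through: "{U \<in> transversals T A m W. v \<in> U - W} = transversals T A m (vec.span (insert v W))"
    if v: "v \<in> ?R" for v
  proof -
    have "v \<notin> W" using v vec.span_base[of v "A \<union> W"] by auto
    moreover have "vec.span (insert v W) \<subseteq> U \<longleftrightarrow> v \<in> U \<and> W \<subseteq> U" if "vec.subspace U" for U
      using that vec.span_minimal[of "insert v W" U] vec.span_superset[of "insert v W"] by auto
    ultimately show ?thesis
      unfolding transversals_def by auto
  qed
  \<comment> \<open>If \<open>v = a + w\<close> lies in \<open>U\<close>, then
    \<open>a = v - w\<close> lies in both \<open>U\<close> and \<open>A\<close>, hence is zero. So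
    \<open>U\<close> meets the span of \<open>A\<close> and \<open>W\<close> only in
    \<open>W\<close>.\<close>
  have outside: "U - W = {v \<in> ?R. v \<in> U - W}" if U: "U \<in> transversals T A m W" for U
  proof -
    have U': "vec.subspace U" "W \<subseteq> U" "U \<subseteq> T" "U \<inter> A = {0}"
      using U by (auto simp: transversals_def)
    have "v \<in> W" if v: "v \<in> U" "v \<in> vec.span (A \<union> W)" for v
    proof -
      obtain a w where aw: "v = a + w" "a \<in> A" "w \<in> W"
        using v(2) assms(2) spanW by (auto simp: vec.span_Un vec.span_eq_iff[THEN iffD2])
      then have "v - w \<in> U" using v(1) U' by (intro vec.subspace_diff) auto
      then have "a = 0" using aw U'(4) by auto
      then show ?thesis using aw by simp
    qed
    then show ?thesis using U' by auto
  qed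
  have inner: "real (card (transversals T A m (vec.span (insert v W)))) * ?P = ?Q"
    if v: "v \<in> ?R" for v
  proof -
    have "v \<notin> W" using v vec.span_base[of v "A \<union> W"] by auto
    then have dim: "vec.dim (vec.span (insert v W)) = Suc ?d"
      by (simp add: vec.dim_insert spanW)
    have "vec.span (insert v W) \<subseteq> T"
      using v Suc.prems assms(1) by (intro vec.span_minimal) auto
    moreover have "vec.span (insert v W) \<inter> A = {0}"
      using v Suc.prems assms(2) by (intro span_insert_Int_trivial) auto
    moreover have "r = m - Suc ?d" "Suc ?d \<le> m" using r by auto
    ultimately show ?thesis
      using Suc.hyps(1)[of "vec.span (insert v W)"] dim by simp
  qed
  have "real (card (transversals T A m W)) * (?q ^ m - ?q ^ ?d) =
        (\<Sum>U\<in>transversals T A m W. real (card (U - W)))"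
  proof -
    have "real (card (U - W)) = ?q ^ m - ?q ^ ?d" if "U \<in> transversals T A m W" for U
    proof -
      have U: "vec.subspace U" "vec.dim U = m" "W \<subseteq> U"
        using that by (auto simp: transversals_def)
      then have "card (U - W) = card U - card W" "card W \<le> card U"
        by (auto intro!: card_Diff_subset card_mono)
      then show ?thesis
        using card_subspace[OF U(1)] card_subspace[OF Suc.prems(1)] U(2) by (simp add: of_nat_diff)
    qed
    then show ?thesis by simp
  qed
  also have "\<dots> = (\<Sum>U\<in>transversals T A m W. \<Sum>v | v \<in> ?R \<and> v \<in> U - W. 1)"
    using outside by (intro sum.cong refl) (metis real_of_card)
  also have "\<dots> = (\<Sum>v\<in>?R. \<Sum>U | U \<in> transversals T A m W \<and> v \<in> U - W. 1)"
    by (rule sum.swap_restrict) auto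
  also have "\<dots> = (\<Sum>v\<in>?R. real (card (transversals T A m (vec.span (insert v W)))))"
    using through by (intro sum.cong refl) simp
  finally have "real (card (transversals T A m W)) * (?q ^ m - ?q ^ ?d) * ?P =
      (\<Sum>v\<in>?R. real (card (transversals T A m (vec.span (insert v W)))) * ?P)"
    by (simp add: sum_distrib_right)
  also have "\<dots> = real (card ?R) * ?Q"
    using inner by simp
  finally show ?case
    \<comment> \<open>The factors for \<open>i = 0\<close> come from the double count; the shifted
      remaining ones form \<open>?P\<close> and \<open>?Q\<close>.\<close>
    unfolding r cardR prod.lessThan_Suc_shift by (simp add: mult.assoc)
qed

text \<open>By the dimension condition each factor on the right of the product formula is
  \<open>CARD('a) ^ vec.dim A\<close> times its counterpart on the left.\<close>

lemma card_complements_through: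
  fixes T A W :: "('a::{field,finite}^'n) set"
  assumes "vec.subspace T" "vec.subspace A" "vec.subspace W"
    and "A \<subseteq> T" "W \<subseteq> T" "W \<inter> A = {0}" "vec.dim W \<le> m" "vec.dim T = vec.dim A + m"
  shows "card (transversals T A m W) = CARD('a) ^ (vec.dim A * (m - vec.dim W))"
proof -
  let ?q = "real CARD('a)"
  let ?P = "\<Prod>i<m - vec.dim W. ?q ^ m - ?q ^ (vec.dim W + i)"
  have "1 < ?q" using card_field_ge_2[where ?'a='a] by simp
  then have "?P \<noteq> 0" by auto
  have "real (card (transversals T A m W)) * ?P =
      (\<Prod>i<m - vec.dim W. ?q ^ vec.dim A * (?q ^ m - ?q ^ (vec.dim W + i)))"
    using card_transversals_prod[OF assms(1-7)] assms(8)
    by (simp add: power_add right_diff_distrib mult.assoc)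
  also have "\<dots> = ?q ^ (vec.dim A * (m - vec.dim W)) * ?P"
    by (simp add: prod.distrib power_mult)
  finally have "real (card (transversals T A m W)) = real (CARD('a) ^ (vec.dim A * (m - vec.dim W)))"
    using \<open>?P \<noteq> 0\<close> by simp
  then show ?thesis by (rule of_nat_eq_iff[THEN iffD1])
qed

text \<open>The case \<open>A = {0}\<close>: pulling a power of the field size out of each factor
  leaves the Gaussian binomial of the quotient of \<open>T\<close> by \<open>W\<close>.\<close>

lemma card_subspaces_through:
  fixes T W :: "('a::{field,finite}^'n) set"
  assumes "vec.subspace T" "vec.subspace W" "W \<subseteq> T" "vec.dim W \<le> m" "m \<le> vec.dim T"
  shows "real (card (transversals T {0} m W)) =
           gauss_binomial CARD('a) (vec.dim T - vec.dim W) (m - vec.dim W)"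
proof -
  let ?q = "real CARD('a)"
  let ?d = "vec.dim W"
  let ?D = "\<Prod>i<m - ?d. ?q ^ (m - ?d - i) - 1"
  let ?E = "\<Prod>i<m - ?d. ?q ^ (?d + i)"
  have q: "1 < ?q" using card_field_ge_2[where ?'a='a] by simp
  have split: "(\<Prod>i<m - ?d. ?q ^ M - ?q ^ (?d + i)) = ?E * (\<Prod>i<m - ?d. ?q ^ (M - ?d - i) - 1)"
    if "m \<le> M" for M
    unfolding prod.distrib[symmetric]
  proof (rule prod.cong)
    fix i assume "i \<in> {..<m - ?d}"
    then have "M = (?d + i) + (M - ?d - i)" using that by auto
    then have "?q ^ M = ?q ^ (?d + i) * ?q ^ (M - ?d - i)"
      by (metis power_add)
    then show "?q ^ M - ?q ^ (?d + i) = ?q ^ (?d + i) * (?q ^ (M - ?d - i) - 1)"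
      by (simp add: right_diff_distrib)
  qed simp
  have "?D \<noteq> 0"
  proof -
    have "?q ^ (m - ?d - i) - 1 \<noteq> 0" if "i < m - ?d" for i
      using one_less_power[OF q, of "m - ?d - i"] that by (simp add: less_diff_conv)
    then show ?thesis by auto
  qed
  moreover have "?E \<noteq> 0" using q by auto
  moreover have "real (card (transversals T {0} m W)) * (?E * ?D) =
      ?E * (\<Prod>i<m - ?d. ?q ^ (vec.dim T - ?d - i) - 1)"
    using card_transversals_prod[of T "{0}" W m] assms split[of m] split[of "vec.dim T"]
    by (auto simp: vec.subspace_0)
  ultimately show ?thesis
    by (simp add: gauss_binomial_def field_simps)
qed

section \<open>Gaussian binomials: positivity and coprimality to the field size\<close>

lemma gauss_binomial_pos:
  assumes "2 \<le> q" "a \<le> b"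
  shows "0 < gauss_binomial q b a"
proof -
  have "0 < real q ^ j - 1" if "0 < j" for j
    using one_less_power[of "real q" j] that assms by simp
  then show ?thesis
    using assms unfolding gauss_binomial_def by (intro divide_pos_pos prod_pos) auto
qed

text \<open>The factors \<open>q ^ (b - i) - 1\<close> of the numerator have positive exponents, so
  they are coprime to \<open>q\<close>, and \<open>c\<close> divides their product. The number
  \<open>c\<close> is introduced because \<open>gauss_binomial\<close> is real-valued.\<close>

lemma coprime_gauss_binomial:
  assumes "2 \<le> q" "a \<le> b" "real c = gauss_binomial q b a"
  shows "coprime (int c) (int q)"
proof -
  have cop: "coprime (\<Prod>i<a. int q ^ (b - i) - 1) (int q)"
  proof (rule prod_coprime_left)
    fix i assume "i \<in> {..<a}"
    then have "b - i \<noteq> 0" using assms by auto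
    then have "int q dvd int q ^ (b - i)" by simp
    then show "coprime (int q ^ (b - i) - 1) (int q)"
      by (metis coprime_commute coprime_diff_one_left coprime_divisors dvd_refl)
  qed
  have "real q ^ (a - i) - 1 \<noteq> 0" if "i < a" for i
    using one_less_power[of "real q" "a - i"] that assms(1) by (simp add: less_imp_neq[THEN not_sym])
  then have "(\<Prod>i<a. real q ^ (a - i) - 1) \<noteq> 0" by auto
  then have "real c * (\<Prod>i<a. real q ^ (a - i) - 1) = (\<Prod>i<a. real q ^ (b - i) - 1)"
    using assms(3) by (simp add: gauss_binomial_def)
  then have "real_of_int (int c * (\<Prod>i<a. int q ^ (a - i) - 1)) =
      real_of_int (\<Prod>i<a. int q ^ (b - i) - 1)"
    by simp
  then have "int c * (\<Prod>i<a. int q ^ (a - i) - 1) = (\<Prod>i<a. int q ^ (b - i) - 1)"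
    by (rule of_int_eq_iff[THEN iffD1])
  with cop show ?thesis
    by (metis coprime_mult_left_iff)
qed

section \<open>Weights on points\<close>

lemma pg_spaces_eq_transversals: "pg_spaces k = transversals UNIV {0} (k + 1) {0}"
  by (auto simp: pg_spaces_def transversals_def vec.subspace_0)

lemma pointE:
  assumes "P \<in> pg_spaces 0"
  obtains v where "v \<noteq> 0" "P = vec.span {v}"
proof -
  have P: "vec.subspace P" "vec.dim P = 1"
    using assms by (auto simp: pg_spaces_def)
  obtain B where B: "vec.independent B" "vec.span B = P" "card B = vec.dim P"
    using vec.basis_subspace_exists[OF P(1)] by metis
  then obtain v where "B = {v}"
    using P(2) card_1_singletonE by metis
  with B that[of v] show ?thesis
    using vec.dependent_zero[of B] by auto
qed

lemma point_Int_subspace: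
  assumes P: "P \<in> pg_spaces 0" and U: "vec.subspace U" and "\<not> P \<subseteq> U"
  shows "P \<inter> U = {0}"
proof -
  obtain v where v: "P = vec.span {v}" using pointE[OF P] by metis
  then have "v \<notin> U"
    using assms(3) U vec.span_minimal[of "{v}" U] by auto
  then have "v \<notin> vec.span (U \<union> {0})"
    using U by (simp add: vec.subspace_0 insert_absorb vec.span_eq_iff[THEN iffD2])
  from span_insert_Int_trivial[OF U vec.subspace_single_0 _ this]
  show ?thesis
    using U v by (simp add: vec.subspace_0 insert_commute)
qed

text \<open>Point weights may be negative or fractional, so integrality and positivity of the weight
  of a subspace require proof.\<close>

definition weight :: "(('a::{field,finite}^'n) set \<Rightarrow> real) \<Rightarrow> ('a^'n) set \<Rightarrow> real" where
  "weight w U = (\<Sum>P | P \<in> pg_spaces 0 \<and> P \<subseteq> U. w P)"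

section \<open>Double counting of points over families of subspaces\<close>

lemma sum_weight:
  "(\<Sum>U\<in>F. weight w U) = (\<Sum>P\<in>pg_spaces 0. w P * real (card {U \<in> F. P \<subseteq> U}))"
proof -
  have "(\<Sum>U\<in>F. weight w U) = (\<Sum>P\<in>pg_spaces 0. \<Sum>U | U \<in> F \<and> P \<subseteq> U. w P)"
    unfolding weight_def by (rule sum.swap_restrict) auto
  then show ?thesis by (simp add: mult.commute)
qed

lemma sum_points_outside:
  fixes w :: "('a::{field,finite}^'n) set \<Rightarrow> real"
  assumes "A \<subseteq> T"
  shows "(\<Sum>P\<in>pg_spaces 0. w P * (if P \<subseteq> T \<and> \<not> P \<subseteq> A then c else 0)) =
           c * (weight w T - weight w A)"
proof -
  have eq: "(\<Sum>P\<in>pg_spaces 0. if P \<subseteq> B then w P else 0) = weight w B" for B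
    unfolding weight_def by (intro sum.inter_filter[symmetric]) auto
  have "(\<Sum>P\<in>pg_spaces 0. w P * (if P \<subseteq> T \<and> \<not> P \<subseteq> A then c else 0)) =
      (\<Sum>P\<in>pg_spaces 0. c * ((if P \<subseteq> T then w P else 0) - (if P \<subseteq> A then w P else 0)))"
    using order_trans[OF _ assms] by (intro sum.cong refl) (simp add: mult.commute)
  also have "\<dots> = c * (\<Sum>P\<in>pg_spaces 0. (if P \<subseteq> T then w P else 0) - (if P \<subseteq> A then w P else 0))"
    by (rule sum_distrib_left[symmetric])
  also have "\<dots> = c * (weight w T - weight w A)"
    unfolding sum_subtractf eq ..
  finally show ?thesis .
qed

text \<open>Members lie in \<open>T\<close> and meet \<open>A\<close> only in zero, so they cover no
  point of \<open>A\<close> and none outside \<open>T\<close>. Every other point meets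
  \<open>A\<close> trivially and is covered \<open>c\<close> times.\<close>

lemma sum_weight_transversals:
  fixes w :: "('a::{field,finite}^'n) set \<Rightarrow> real"
  assumes A: "vec.subspace A" "A \<subseteq> T"
    and c: "\<And>P. P \<in> pg_spaces 0 \<Longrightarrow> P \<subseteq> T \<Longrightarrow> P \<inter> A = {0} \<Longrightarrow>
      real (card (transversals T A m P)) = c"
  shows "(\<Sum>U\<in>transversals T A m {0}. weight w U) = c * (weight w T - weight w A)"
proof -
  have card: "real (card {U \<in> transversals T A m {0}. P \<subseteq> U}) =
      (if P \<subseteq> T \<and> \<not> P \<subseteq> A then c else 0)" if P: "P \<in> pg_spaces 0" for P
  proof (cases "P \<subseteq> T \<and> \<not> P \<subseteq> A")
    case True
    have "{U \<in> transversals T A m {0}. P \<subseteq> U} = transversals T A m P"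
      unfolding transversals_def by (intro set_eqI) (simp, metis vec.subspace_0)
    then show ?thesis
      using True c[OF P] point_Int_subspace[OF P A(1)] by simp
  next
    case False
    have "\<not> P \<subseteq> {0}" using P by (simp add: pg_spaces_def flip: vec.dim_eq_0)
    then have "\<not> P \<subseteq> U" if "U \<subseteq> T" "U \<inter> A = {0}" for U
      using False that Int_greatest[of P U A] order_trans[of P U T] by metis
    then have "{U \<in> transversals T A m {0}. P \<subseteq> U} = {}"
      by (intro equals0I) (simp add: transversals_def, metis)
    then show ?thesis using False by (simp only: card.empty of_nat_0 if_False)
  qed
  have "(\<Sum>U\<in>transversals T A m {0}. weight w U) =
      (\<Sum>P\<in>pg_spaces 0. w P * (if P \<subseteq> T \<and> \<not> P \<subseteq> A then c else 0))"
    unfolding sum_weight using card by (intro sum.cong refl) (simp only:)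
  also have "\<dots> = c * (weight w T - weight w A)"
    by (rule sum_points_outside[OF A(2)])
  finally show ?thesis .
qed

lemma weight_zero [simp]:
  fixes w :: "('a::{field,finite}^'n) set \<Rightarrow> real"
  shows "weight w {0} = 0"
proof -
  have "{P. P \<in> pg_spaces 0 \<and> P \<subseteq> {0}} = ({} :: ('a^'n) set set)"
    by (auto simp: pg_spaces_def simp flip: vec.dim_eq_0)
  then show ?thesis unfolding weight_def by (simp only: sum.empty)
qed

text \<open>Each point of \<open>T\<close> lies in equally many \<open>m\<close>-dimensional
  subspaces of \<open>T\<close>. For the whole space this yields the parameter, for a
  \<open>t\<close>-space integrality and positivity.\<close>

lemma sum_weight_subspaces:
  fixes w :: "('a::{field,finite}^'n) set \<Rightarrow> real"
  assumes "vec.subspace T" "1 \<le> m" "m \<le> vec.dim T"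
  shows "(\<Sum>U\<in>transversals T {0} m {0}. weight w U) =
           gauss_binomial CARD('a) (vec.dim T - 1) (m - 1) * weight w T"
proof -
  have "real (card (transversals T {0} m P)) = gauss_binomial CARD('a) (vec.dim T - 1) (m - 1)"
    if "P \<in> pg_spaces 0" "P \<subseteq> T" for P
    using that assms card_subspaces_through[of T P m] by (simp add: pg_spaces_def)
  then show ?thesis
    using sum_weight_transversals[of "{0}" T m] assms by (simp add: vec.subspace_0)
qed

section \<open>Integrality of the weight of a subspace\<close>

text \<open>A \<open>q\<close>-power multiple suffices, and this replaces the spreads of the classical argument: the
  complements of a subspace of codimension \<open>m\<close> cover every point outside it equally often, namely a
  power of \<open>q\<close> times.\<close>

lemma power_mult_weight_in_Ints:
  fixes w :: "('a::{field,finite}^'n) set \<Rightarrow> real"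
  assumes "1 \<le> m" and "\<And>U. vec.subspace U \<Longrightarrow> vec.dim U = m \<Longrightarrow> weight w U \<in> \<int>"
    and "vec.subspace T" "vec.dim T = s * m"
  shows "\<exists>e. real CARD('a) ^ e * weight w T \<in> \<int>"
  using assms(3,4)
proof (induction s arbitrary: T)
  case 0
  then have "T = {0}" using vec.subspace_0[of T] by auto
  then show ?case by simp
next
  case (Suc s)
  let ?q = "real CARD('a)"
  \<comment> \<open>With \<open>A\<close> of codimension \<open>m\<close>, the induction hypothesis
    applies to \<open>A\<close>, and its complements in \<open>T\<close> have dimension
    \<open>m\<close>, hence integral weight.\<close>
  obtain A where A: "vec.subspace A" "A \<subseteq> T" "vec.dim A = s * m"
  proof -
    have "s * m \<le> vec.dim T" "vec.span T = T" using Suc.prems by simp_all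
    then show ?thesis using vec.choose_subspace_of_subspace[of "s * m" T] that by metis
  qed
  then obtain e where e: "?q ^ e * weight w A \<in> \<int>"
    using Suc.IH by blast
  define f where "f = vec.dim A * (m - 1)"
  have "(\<Sum>U\<in>transversals T A m {0}. weight w U) = ?q ^ f * (weight w T - weight w A)"
  proof (rule sum_weight_transversals[OF A(1,2)])
    fix P assume "P \<in> pg_spaces 0" "P \<subseteq> T" "P \<inter> A = {0}"
    then show "real (card (transversals T A m P)) = ?q ^ f"
      using card_complements_through[of T A P m] A Suc.prems assms(1)
      by (simp add: pg_spaces_def f_def)
  qed
  moreover have "(\<Sum>U\<in>transversals T A m {0}. weight w U) \<in> \<int>"
    using assms(2) by (intro Ints_sum) (auto simp: transversals_def)
  ultimately have "?q ^ f * (weight w T - weight w A) \<in> \<int>" by simp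
  moreover have "?q ^ j \<in> \<int>" for j by (intro Ints_power) simp
  \<comment> \<open>The terms in \<open>weight w A\<close> cancel, which leaves
    \<open>?q ^ (e + f) * weight w T\<close>.\<close>
  ultimately have "?q ^ e * (?q ^ f * (weight w T - weight w A)) + ?q ^ f * (?q ^ e * weight w A) \<in> \<int>"
    using e by (metis Ints_add Ints_mult)
  then have "?q ^ (e + f) * weight w T \<in> \<int>"
    by (simp add: algebra_simps power_add)
  then show ?case by blast
qed

text \<open>Bezout coefficients write \<open>y\<close> as an integer combination of the integers
  \<open>a * y\<close> and \<open>b * y\<close>.\<close>

lemma Ints_of_coprime_multiples:
  fixes y :: real
  assumes "coprime (a::int) b" "of_int a * y \<in> \<int>" "of_int b * y \<in> \<int>"
  shows "y \<in> \<int>"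
proof -
  obtain u v where "u * a + v * b = 1"
    using bezout_int[of a b] assms(1) by auto
  then have "of_int (u * a + v * b) * y = y"
    by (simp only: of_int_1 mult_1_left)
  then have "y = of_int u * (of_int a * y) + of_int v * (of_int b * y)"
    by (simp add: algebra_simps)
  also have "\<dots> \<in> \<int>"
    by (rule Ints_add[OF Ints_mult[OF Ints_of_int assms(2)] Ints_mult[OF Ints_of_int assms(3)]])
  finally show ?thesis .
qed

text \<open>Removes the power of the field size: summing over all \<open>m\<close>-dimensional
  subspaces of \<open>T\<close> makes a Gaussian binomial multiple of the weight integral too, and
  this factor is coprime to that power.\<close>

lemma weight_in_Ints:
  fixes w :: "('a::{field,finite}^'n) set \<Rightarrow> real"
  assumes "1 \<le> m" and "\<And>U. vec.subspace U \<Longrightarrow> vec.dim U = m \<Longrightarrow> weight w U \<in> \<int>"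
    and T: "vec.subspace T" "m dvd vec.dim T" "m \<le> vec.dim T"
  shows "weight w T \<in> \<int>"
proof -
  obtain s where "vec.dim T = s * m" using T(2) by (auto simp: dvd_def mult.commute)
  then obtain e where e: "real CARD('a) ^ e * weight w T \<in> \<int>"
    using power_mult_weight_in_Ints[OF assms(1,2) T(1)] by metis
  \<comment> \<open>The point \<open>P\<close> serves to exhibit the Gaussian binomial as a
    cardinality, hence as an integer.\<close>
  obtain P where P: "vec.subspace P" "P \<subseteq> T" "vec.dim P = 1"
  proof -
    have "1 \<le> vec.dim T" "vec.span T = T" using T assms(1) by simp_all
    then show ?thesis using vec.choose_subspace_of_subspace[of 1 T] that by metis
  qed
  define c where "c = card (transversals T {0} m P)"
  have c: "real c = gauss_binomial CARD('a) (vec.dim T - 1) (m - 1)"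
    using card_subspaces_through[of T P m] P T assms(1) by (simp add: c_def)
  then have "coprime (int c) (int CARD('a))"
    using T assms(1) by (intro coprime_gauss_binomial card_field_ge_2) auto
  then have "coprime (int c) (int CARD('a) ^ e)"
    by simp
  moreover have "real c * weight w T \<in> \<int>"
    unfolding c sum_weight_subspaces[OF T(1) assms(1) T(3), symmetric]
    by (rule Ints_sum) (simp add: transversals_def assms(2))
  ultimately show ?thesis
    using e Ints_of_coprime_multiples[of "int c" "int CARD('a) ^ e" "weight w T"] by simp
qed

text \<open>A point of \<open>K\<close> lies in every member. For a point outside \<open>K\<close>,
  the members through it are those through its span with \<open>K\<close>, which has one dimension
  more than \<open>K\<close>.\<close>

lemma sum_weight_containing:
  fixes w :: "('a::{field,finite}^'n) set \<Rightarrow> real"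
  assumes K: "vec.subspace K" and "vec.dim K < m" "m \<le> CARD('n)"
  shows "(\<Sum>T\<in>transversals UNIV {0} m K. weight w T) =
      real (card (transversals UNIV {0} m K)) * weight w K +
      gauss_binomial CARD('a) (CARD('n) - vec.dim K - 1) (m - vec.dim K - 1) *
        (weight w UNIV - weight w K)"
proof -
  let ?F = "transversals UNIV {0} m K"
  let ?G = "gauss_binomial CARD('a) (CARD('n) - vec.dim K - 1) (m - vec.dim K - 1)"
  \<comment> \<open>The conditions \<open>\<not> P \<subseteq> {0}\<close> and
    \<open>P \<subseteq> UNIV\<close> hold for every point; they give both summands the form of
    \<open>sum_points_outside\<close>.\<close>
  have "real (card {T \<in> ?F. P \<subseteq> T}) =
      (if P \<subseteq> K \<and> \<not> P \<subseteq> {0} then real (card ?F) else 0) +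
      (if P \<subseteq> UNIV \<and> \<not> P \<subseteq> K then ?G else 0)"
    if P: "P \<in> pg_spaces 0" for P
  proof (cases "P \<subseteq> K")
    case True
    then have "{T \<in> ?F. P \<subseteq> T} = ?F" by (auto simp: transversals_def)
    moreover have "\<not> P \<subseteq> {0}" using P by (simp add: pg_spaces_def flip: vec.dim_eq_0)
    ultimately show ?thesis using True by simp
  next
    case False
    obtain v where v: "P = vec.span {v}" using pointE[OF P] by metis
    have sub: "P \<subseteq> U \<longleftrightarrow> v \<in> U" if "vec.subspace U" for U
      using that v vec.span_minimal[of "{v}" U] vec.span_superset[of "{v}"] by auto
    have "vec.span (insert v K) \<subseteq> U \<longleftrightarrow> v \<in> U \<and> K \<subseteq> U" if "vec.subspace U" for U
      using that vec.span_minimal[of "insert v K" U] vec.span_superset[of "insert v K"] by auto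
    then have "{T \<in> ?F. P \<subseteq> T} = transversals UNIV {0} m (vec.span (insert v K))"
      using sub unfolding transversals_def by blast
    moreover have "vec.dim (vec.span (insert v K)) = vec.dim K + 1"
      using False sub[OF K] K by (simp add: vec.dim_insert vec.span_eq_iff[THEN iffD2])
    ultimately show ?thesis
      using False assms card_subspaces_through[of UNIV "vec.span (insert v K)" m]
      by (simp add: vec_dim_card del: vec.dim_UNIV)
  qed
  then have "(\<Sum>T\<in>?F. weight w T) =
      (\<Sum>P\<in>pg_spaces 0. w P * (if P \<subseteq> K \<and> \<not> P \<subseteq> {0} then real (card ?F) else 0)) +
      (\<Sum>P\<in>pg_spaces 0. w P * (if P \<subseteq> UNIV \<and> \<not> P \<subseteq> K then ?G else 0))"
    unfolding sum_weight sum.distrib[symmetric] by (intro sum.cong) (simp_all only: distrib_left)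
  also have "\<dots> = real (card ?F) * (weight w K - weight w {0}) + ?G * (weight w UNIV - weight w K)"
    using K by (intro arg_cong2[where f = plus] sum_points_outside) (auto simp: vec.subspace_0)
  finally show ?thesis by simp
qed

section \<open>Cameron-Liebler sets\<close>

text \<open>Coefficients belong to row indices, so coinciding rows, such as the zero rows that pad
  the incidence matrix, cause no conflict. Adding a multiple of row \<open>i0\<close> changes the
  coefficient at \<open>i0\<close> alone.\<close>

lemma span_rows_imp_combination:
  fixes M :: "real^'c^'r"
  assumes "y \<in> span (rows M)"
  obtains u where "\<And>j. y $ j = (\<Sum>i\<in>UNIV. u i * M $ i $ j)"
proof -
  have "\<exists>u. \<forall>j. y $ j = (\<Sum>i\<in>UNIV. u i * M $ i $ j)"
    using assms
  proof (induction rule: span_induct_alt)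
    case base
    show ?case by (rule exI[of _ "\<lambda>_. 0"]) simp
  next
    case (step c x y)
    then obtain u i0 where u: "\<forall>j. y $ j = (\<Sum>i\<in>UNIV. u i * M $ i $ j)" and x: "x = row i0 M"
      by (auto simp: rows_def)
    have "(\<Sum>i\<in>UNIV. (u i + (if i = i0 then c else 0)) * M $ i $ j) = (c *\<^sub>R x + y) $ j" for j
    proof -
      have "(\<Sum>i\<in>UNIV. (u i + (if i = i0 then c else 0)) * M $ i $ j) =
          (\<Sum>i\<in>UNIV. u i * M $ i $ j) + (\<Sum>i\<in>UNIV. if i = i0 then c * M $ i $ j else 0)"
        unfolding sum.distrib[symmetric] by (intro sum.cong) (auto simp: algebra_simps)
      then show ?thesis using u x by (simp add: row_def)
    qed
    then show ?case by (intro exI[of _ "\<lambda>i. u i + (if i = i0 then c else 0)"]) simp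
  qed
  with that show ?thesis by blast
qed

text \<open>The coefficients of a row combination equal to the characteristic vector serve as point
  weights: column \<open>K\<close> of the matrix selects the points of \<open>K\<close>.\<close>

lemma cameron_liebler_weight:
  fixes L :: "('a::{field,finite}^'n) set set"
  assumes "cameron_liebler k L"
  obtains w where "\<And>K. K \<in> pg_spaces k \<Longrightarrow> weight w K = (if K \<in> L then 1 else 0)"
proof -
  obtain u where u: "\<And>K. char_vector L $ K = (\<Sum>P\<in>UNIV. u P * pg_incidence_matrix k $ P $ K)"
    using assms span_rows_imp_combination unfolding cameron_liebler_def by blast
  have "weight u K = (if K \<in> L then 1 else 0)" if "K \<in> pg_spaces k" for K
  proof -
    have "weight u K = (\<Sum>P\<in>UNIV. if P \<in> pg_spaces 0 \<and> P \<subseteq> K then u P else 0)"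
      unfolding weight_def using sum.inter_filter[of UNIV u] by simp
    also have "\<dots> = (\<Sum>P\<in>UNIV. u P * pg_incidence_matrix k $ P $ K)"
      using that by (intro sum.cong) (auto simp: pg_incidence_matrix_def)
    also have "\<dots> = (if K \<in> L then 1 else 0)"
      using u[of K] by (simp add: char_vector_def)
    finally show ?thesis .
  qed
  with that show ?thesis by blast
qed

theorem theorem5p1:
  fixes L :: "('a::{field,finite}^'n) set set"
    and n k q :: nat and x :: real
  assumes "CARD('a) = q" and "CARD('n) = n + 1"
    and "cameron_liebler k L" and "L \<noteq> {}"
    and "has_parameter k L x"
  shows "\<forall>t::nat. (k + 1) dvd (t + 1) \<and> 2 * k + 1 \<le> t \<and> t \<le> n - 1 \<longrightarrow>
           (\<exists>C::nat. x = 1 + real C / gauss_binomial q (n - k - 1) (t - k - 1))"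
proof (intro allI impI, elim conjE)
  fix t assume t: "(k + 1) dvd (t + 1)" "2 * k + 1 \<le> t" "t \<le> n - 1"
  obtain w where w: "\<And>K. K \<in> pg_spaces k \<Longrightarrow> weight w K = (if K \<in> L then 1 else 0)"
    using cameron_liebler_weight[OF assms(3)] by metis
  \<comment> \<open>The subtraction in \<open>t \<le> n - 1\<close> is truncated, but
    \<open>2 * k + 1 \<le> t\<close> excludes \<open>n = 0\<close>.\<close>
  have kn: "k \<le> n" using t by linarith
  have q: "2 \<le> q" using card_field_ge_2[where ?'a='a] assms(1) by simp
  have L: "L \<subseteq> pg_spaces k" using assms(3) by (simp add: cameron_liebler_def)
  obtain K where K: "K \<in> L" using assms(4) by blast
  then have K': "vec.subspace K" "vec.dim K = k + 1" "weight w K = 1"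
    using L w by (auto simp: pg_spaces_def)
  \<comment> \<open>The weights of all \<open>k\<close>-spaces add up to \<open>card L\<close>, and
    also to \<open>gauss_binomial q n k\<close> times the total weight.\<close>
  have x: "weight w UNIV = x"
  proof -
    have "(\<Sum>U\<in>pg_spaces k. weight w U) = (\<Sum>U\<in>pg_spaces k. if U \<in> L then 1 else 0)"
      by (intro sum.cong refl w)
    also have "\<dots> = real (card L)"
      using L by (simp add: sum.If_cases Int_absorb1)
    also have "\<dots> = gauss_binomial q n k * x"
      using assms(1,2,5) by (simp add: has_parameter_def)
    finally have "gauss_binomial q n k * weight w UNIV = gauss_binomial q n k * x"
      using sum_weight_subspaces[of UNIV "k + 1" w] assms(1,2) kn
      by (auto simp: pg_spaces_eq_transversals vec_dim_card simp del: vec.dim_UNIV)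
    moreover have "gauss_binomial q n k \<noteq> 0"
      using gauss_binomial_pos[OF q, of k n] kn by simp
    ultimately show ?thesis by simp
  qed
  have ge1: "weight w T \<in> \<int> \<and> 1 \<le> weight w T" if "T \<in> transversals UNIV {0} (t + 1) K" for T
  proof -
    have T: "vec.subspace T" "vec.dim T = t + 1" "K \<subseteq> T"
      using that by (auto simp: transversals_def)
    have "weight w U \<in> \<int>" if "vec.subspace U" "vec.dim U = k + 1" for U
      using that w[of U] by (simp add: pg_spaces_def)
    then have int: "weight w T \<in> \<int>"
      using weight_in_Ints[of "k + 1" w T] T t by simp
    \<comment> \<open>All \<open>k\<close>-spaces in \<open>T\<close> have weight 0 or 1 and
      \<open>K\<close> contributes 1, so their sum, a positive multiple of the weight of
      \<open>T\<close>, is positive.\<close>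
    have nonneg: "0 \<le> weight w U" if "U \<in> transversals T {0} (k + 1) {0}" for U
    proof -
      have "U \<in> pg_spaces k" using that by (simp add: pg_spaces_def transversals_def)
      then show ?thesis by (simp add: w)
    qed
    have "K \<in> transversals T {0} (k + 1) {0}"
      using K' T by (simp add: transversals_def vec.subspace_0)
    then have "weight w K \<le> (\<Sum>U\<in>transversals T {0} (k + 1) {0}. weight w U)"
      by (rule member_le_sum) (simp_all add: nonneg)
    then have "0 < gauss_binomial q t k * weight w T"
      using sum_weight_subspaces[of T "k + 1" w] T t K' assms(1) by simp
    then have "0 < weight w T"
      using gauss_binomial_pos[OF q, of k t] t by (simp add: zero_less_mult_iff)
    with int show ?thesis
      by (auto elim: Ints_cases)
  qed
  let ?F = "transversals UNIV {0} (t + 1) K"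
  let ?G = "gauss_binomial q (n - k - 1) (t - k - 1)"
  \<comment> \<open>By \<open>ge1\<close> these differences are natural numbers; their sum over
    \<open>?F\<close> is the witness for \<open>C\<close>.\<close>
  have "weight w T - 1 = real (nat \<lfloor>weight w T - 1\<rfloor>)" if "T \<in> ?F" for T
    using ge1[OF that] by (auto elim: Ints_cases)
  then have "(\<Sum>T\<in>?F. weight w T - 1) = real (\<Sum>T\<in>?F. nat \<lfloor>weight w T - 1\<rfloor>)"
    unfolding of_nat_sum by (intro sum.cong refl)
  \<comment> \<open>As \<open>weight w K = 1\<close>, the term \<open>card ?F * weight w K\<close>
    cancels against the subtracted ones. The dimension \<open>k + 1\<close> of \<open>K\<close>
    turns the binomial into \<open>?G\<close>.\<close>
  moreover have "(\<Sum>T\<in>?F. weight w T - 1) = ?G * (x - 1)"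
    using sum_weight_containing[OF K'(1), of "t + 1" w] K' x assms(1,2) t
    by (simp add: sum_subtractf)
  moreover have "0 < ?G" using gauss_binomial_pos[OF q] t by simp
  ultimately have "x = 1 + real (\<Sum>T\<in>?F. nat \<lfloor>weight w T - 1\<rfloor>) / ?G"
    by (simp add: field_simps)
  then show "\<exists>C::nat. x = 1 + real C / ?G" by blast
qed

end
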